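(* For the multi-buffer, multi-server queueing problem with delay-dependent rewards described in the context, the myopic policy earns total expected reward over $T$ periods within a factor of $2$ of (i.e. at least one half of) that of the optimal policy. Moreover this guarantee holds relative to an optimal policy that has full knowledge of the entire job-arrival process in advance.
   Context: Queueing model. There are $I$ buffers and $J$ servers and time is discrete, $t=0,1,\dots,T-1$. Each buffer sees a general exogenous discrete-time arrival process with at most one arrival per buffer in a given time slot. In each time slot one chooses a matching between servers and available (arrived, uncompleted) jobs: each server serves at most one job and each job is served by at most one server. Service is preemptive. If server $j$ serves a job that arrived to buffer $i$, the service time is an independent geometric random variable with mean $\mu_{i,j}\in[1,\infty]$; that is, in each slot in which the job is served by server $j$ it is completed with probability $1/\mu_{i,j}$ (interpreted as $0$ if $\mu_{i,j}=\infty$), independently of everything else. A job of buffer $i$ completed after having been in the system for time $d$ (completion slot minus arrival slot) earns reward $r_{i,d}\ge0$, where $r_{i,d}$ is non-increasing in $d$. The objective is to maximize the expected total reward earned over $T$ periods. An adaptive policy chooses the matching in each slot based on the information available up to that time. The myopic policy chooses in each slot a matching maximizing the expected reward earned in that slot, namely the sum over matched pairs of $r_{i,d}/\mu_{i,j}$, where $i$ is the job's buffer, $d$ its current delay, and $j$ its server. *)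

theory Defs
  imports "HOL-Probability.Probability"
begin

text \<open>
  Buffers are \<open>0, \<dots>, I - 1\<close>, servers \<open>0, \<dots>, J - 1\<close>, slots \<open>0, \<dots>, T - 1\<close>. Since a buffer sees at
  most one arrival per slot, a job is identified with its pair (buffer, arrival slot), and a
  realisation of the arrival process over the horizon is a set of jobs.
\<close>

type_synonym job = "nat \<times> nat"

definition arrival_paths :: "nat \<Rightarrow> nat \<Rightarrow> job set set" where
  "arrival_paths I T = Pow ({..<I} \<times> {..<T})"

text \<open>Server \<open>j\<close> serves the job \<open>M j\<close>, and idles if \<open>M j = None\<close>.\<close>

type_synonym matching = "nat \<rightharpoonup> job"

text \<open>
  A history lists, for each elapsed slot in chronological order, the matching used and the set of
  jobs completed in that slot. The current slot is therefore the length of the history.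
\<close>

type_synonym history = "(matching \<times> job set) list"

definition arrived :: "job set \<Rightarrow> nat \<Rightarrow> job set" where
  "arrived A t = {(i, s) \<in> A. s \<le> t}"

definition available :: "job set \<Rightarrow> history \<Rightarrow> job set" where
  "available A h = arrived A (length h) - (\<Union>(M, C) \<in> set h. C)"

definition is_matching :: "nat \<Rightarrow> job set \<Rightarrow> matching \<Rightarrow> bool" where
  "is_matching J S M \<longleftrightarrow> dom M \<subseteq> {..<J} \<and> ran M \<subseteq> S \<and> inj_on M (dom M)"

text \<open>In \<^typ>\<open>ereal\<close> we have \<open>1 / \<infinity> = 0\<close>, so a pair with infinite mean never completes.\<close>

definition completion_prob :: "(nat \<Rightarrow> nat \<Rightarrow> ereal) \<Rightarrow> nat \<Rightarrow> nat \<Rightarrow> real" where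
  "completion_prob mu i j = real_of_ereal (1 / mu i j)"

definition completions :: "(nat \<Rightarrow> nat \<Rightarrow> ereal) \<Rightarrow> matching \<Rightarrow> job set pmf" where
  "completions mu M =
     map_pmf (\<lambda>success. {k. \<exists>j. M j = Some k \<and> success j})
       (Pi_pmf (dom M) False (\<lambda>j. bernoulli_pmf (completion_prob mu (fst (the (M j))) j)))"

text \<open>
  A policy may randomise over matchings. It receives the whole arrival path, so that without
  further restriction it is clairvoyant about arrivals (but not about service completions).
  Adaptive policies are those that depend on the path only through the arrivals so far.
\<close>

type_synonym policy = "job set \<Rightarrow> history \<Rightarrow> matching pmf"

definition clairvoyant_policies :: "nat \<Rightarrow> nat \<Rightarrow> nat \<Rightarrow> policy set" where
  "clairvoyant_policies I J T =
     {\<pi>. \<forall>A\<in>arrival_paths I T. \<forall>h. length h < T \<longrightarrow>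
           (\<forall>M\<in>set_pmf (\<pi> A h). is_matching J (available A h) M)}"

definition adaptive_policies :: "nat \<Rightarrow> nat \<Rightarrow> nat \<Rightarrow> policy set" where
  "adaptive_policies I J T =
     {\<pi> \<in> clairvoyant_policies I J T.
        \<forall>A\<in>arrival_paths I T. \<forall>A'\<in>arrival_paths I T. \<forall>h. length h < T \<longrightarrow>
          arrived A (length h) = arrived A' (length h) \<longrightarrow> \<pi> A h = \<pi> A' h}"

primrec trajectory ::
  "(nat \<Rightarrow> nat \<Rightarrow> ereal) \<Rightarrow> policy \<Rightarrow> job set \<Rightarrow> nat \<Rightarrow> history pmf" where
  "trajectory mu \<pi> A 0 = return_pmf []"
| "trajectory mu \<pi> A (Suc t) =
     bind_pmf (trajectory mu \<pi> A t) (\<lambda>h.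
     bind_pmf (\<pi> A h) (\<lambda>M.
     bind_pmf (completions mu M) (\<lambda>C.
     return_pmf (h @ [(M, C)]))))"

definition total_reward :: "(nat \<Rightarrow> nat \<Rightarrow> real) \<Rightarrow> history \<Rightarrow> real" where
  "total_reward r h = (\<Sum>t<length h. \<Sum>(i, s)\<in>snd (h ! t). r i (t - s))"

text \<open>
  The arrival path is drawn first, from an arbitrary law, and neither the policy nor the service
  completions influence it: this is what makes the arrivals exogenous.
\<close>

definition expected_reward ::
  "nat \<Rightarrow> (nat \<Rightarrow> nat \<Rightarrow> ereal) \<Rightarrow> (nat \<Rightarrow> nat \<Rightarrow> real) \<Rightarrow> job set pmf \<Rightarrow> policy \<Rightarrow> real" where
  "expected_reward T mu r arr \<pi> =
     measure_pmf.expectation (bind_pmf arr (\<lambda>A. trajectory mu \<pi> A T)) (total_reward r)"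

definition slot_reward ::
  "(nat \<Rightarrow> nat \<Rightarrow> ereal) \<Rightarrow> (nat \<Rightarrow> nat \<Rightarrow> real) \<Rightarrow> nat \<Rightarrow> matching \<Rightarrow> real" where
  "slot_reward mu r t M =
     (\<Sum>j\<in>dom M. case the (M j) of (i, s) \<Rightarrow> r i (t - s) * completion_prob mu i j)"

text \<open>Ties between maximising matchings may be broken arbitrarily.\<close>

definition myopic_policies ::
  "nat \<Rightarrow> nat \<Rightarrow> nat \<Rightarrow> (nat \<Rightarrow> nat \<Rightarrow> ereal) \<Rightarrow> (nat \<Rightarrow> nat \<Rightarrow> real) \<Rightarrow> policy set" where
  "myopic_policies I J T mu r =
     {\<pi> \<in> adaptive_policies I J T.
        \<forall>A\<in>arrival_paths I T. \<forall>h. length h < T \<longrightarrow>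
          (\<forall>M\<in>set_pmf (\<pi> A h). \<forall>M'. is_matching J (available A h) M' \<longrightarrow>
             slot_reward mu r (length h) M' \<le> slot_reward mu r (length h) M)}"

text \<open>The supremum is taken in \<^typ>\<open>ereal\<close>, where it exists unconditionally.\<close>

definition optimal_reward ::
  "policy set \<Rightarrow> nat \<Rightarrow> (nat \<Rightarrow> nat \<Rightarrow> ereal) \<Rightarrow> (nat \<Rightarrow> nat \<Rightarrow> real) \<Rightarrow> job set pmf \<Rightarrow> ereal" where
  "optimal_reward P T mu r arr = (SUP \<pi>\<in>P. ereal (expected_reward T mu r arr \<pi>))"

end

theory Submission imports Defs begin

text \<open>
  Fix the arrival path \<open>A\<close> and let \<open>V\<^sub>t(R)\<close> be the optimal expected reward that can still be earned
  from slot \<open>t\<close> on when the jobs \<open>R \<subseteq> A\<close>, arrived or not, are uncompleted. Removing a set \<open>D\<close> of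
  jobs from \<open>R\<close> does not increase \<open>V\<^sub>t\<close> (\<open>opt_value_mono\<close>), and it decreases \<open>V\<^sub>t\<close> by at most what
  the jobs of \<open>D\<close> would earn if all were completed in slot \<open>t\<close>, those yet to arrive with delay
  \<open>0\<close> (\<open>opt_value_le_removed\<close>): rewards
  are non-increasing in the delay, and the optimal policy can be imitated by idling whenever it
  serves a job of \<open>D\<close>.

  Let \<open>M\<^sup>*\<close> be an optimal and \<open>M\<close> a myopic matching in slot \<open>t\<close>, and let \<open>C\<close> be the random set of
  jobs completed under \<open>M\<close>. By the first property \<open>V\<^sub>t(R)\<close> is at most the slot reward of \<open>M\<^sup>*\<close>
  plus \<open>V\<^sub>t\<^sub>+\<^sub>1(R)\<close>; the slot reward of \<open>M\<^sup>*\<close> is at most that of \<open>M\<close>, and by the second property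
  \<open>V\<^sub>t\<^sub>+\<^sub>1(R)\<close> is at most the expectation of \<open>V\<^sub>t\<^sub>+\<^sub>1(R - C)\<close> plus, once more, the slot reward of
  \<open>M\<close>. Hence twice the myopic slot reward plus the expected new value is at least the old value
  (\<open>opt_value_le_myopic_step\<close>). So under the myopic policy the expectation of twice the reward
  earned so far plus \<open>V\<^sub>t\<close> of the uncompleted jobs is non-decreasing in \<open>t\<close>, whence
  \<open>V\<^sub>0(A)\<close> is at most twice the myopic reward. Under an arbitrary clairvoyant policy the reward
  earned so far plus \<open>V\<^sub>t\<close> is non-increasing in expectation, whence the policy earns at most
  \<open>V\<^sub>0(A)\<close>. Averaging over \<open>A\<close> gives the theorem.
\<close>

section \<open>Expectations of finitely supported distributions\<close>

lemma expectation_mono_finite: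
  fixes f g :: "'a \<Rightarrow> real"
  assumes "finite (set_pmf p)" and "\<And>x. x \<in> set_pmf p \<Longrightarrow> f x \<le> g x"
  shows "measure_pmf.expectation p f \<le> measure_pmf.expectation p g"
  using assms by (intro integral_mono_AE integrable_measure_pmf_finite) (auto simp: AE_measure_pmf_iff)

lemma expectation_ge_const:
  fixes f :: "'a \<Rightarrow> real"
  assumes "finite (set_pmf p)" and "\<And>x. x \<in> set_pmf p \<Longrightarrow> c \<le> f x"
  shows "c \<le> measure_pmf.expectation p f"
  using expectation_mono_finite[of p "\<lambda>_. c" f] assms by simp

lemma expectation_le_const:
  fixes f :: "'a \<Rightarrow> real"
  assumes "finite (set_pmf p)" and "\<And>x. x \<in> set_pmf p \<Longrightarrow> f x \<le> c"
  shows "measure_pmf.expectation p f \<le> c"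
  using expectation_mono_finite[of p f "\<lambda>_. c"] assms by simp

lemma expectation_bind_finite:
  fixes g :: "'b \<Rightarrow> real"
  assumes "finite (set_pmf p)" and "\<And>x. x \<in> set_pmf p \<Longrightarrow> finite (set_pmf (f x))"
  shows "measure_pmf.expectation (bind_pmf p f) g
           = measure_pmf.expectation p (\<lambda>x. measure_pmf.expectation (f x) g)"
  using assms by (simp add: pmf_expectation_bind[of "set_pmf p"] integral_measure_pmf[of "set_pmf p"])

section \<open>Matchings and completions\<close>

lemma finite_matchings:
  assumes "finite S"
  shows "finite {M. is_matching J S M}"
proof (rule finite_subset)
  show "{M. is_matching J S M} \<subseteq> (\<Union>D\<in>Pow {..<J}. {M. dom M = D \<and> ran M \<subseteq> S})"
    by (auto simp: is_matching_def)
  show "finite (\<Union>D\<in>Pow {..<J}. {M. dom M = D \<and> ran M \<subseteq> S})"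
    using assms by (intro finite_UN_I finite_set_of_finite_maps) (auto intro: finite_subset)
qed

lemma is_matching_empty: "is_matching J S Map.empty"
  by (simp add: is_matching_def)

lemma is_matching_mono: "is_matching J S M \<Longrightarrow> S \<subseteq> S' \<Longrightarrow> is_matching J S' M"
  by (auto simp: is_matching_def)

lemma is_matching_finite_dom: "is_matching J S M \<Longrightarrow> finite (dom M)"
  by (auto simp: is_matching_def intro: finite_subset)

lemma set_completions_subset: "C \<in> set_pmf (completions mu M) \<Longrightarrow> C \<subseteq> ran M"
  by (auto simp: completions_def ran_def)

lemma finite_set_completions:
  assumes "finite (dom M)"
  shows "finite (set_pmf (completions mu M))"
  by (rule finite_subset[of _ "Pow (ran M)"])
     (use assms set_completions_subset finite_ran in auto)

text \<open>
  Withdrawing the servers that \<open>M\<close> assigns to jobs of \<open>D\<close> only removes the jobs of \<open>D\<close> from the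
  completed set: the successes at the other servers are unaffected.
\<close>

lemma completions_restrict:
  assumes "finite (dom M)"
  shows "completions mu (M |` {j. the (M j) \<notin> D}) = map_pmf (\<lambda>C. C - D) (completions mu M)"
proof -
  let ?M = "M |` {j. the (M j) \<notin> D}"
  let ?b = "\<lambda>M j. bernoulli_pmf (completion_prob mu (fst (the (M j))) j)"
  have sub: "dom ?M \<subseteq> dom M" by auto
  have "Pi_pmf (dom ?M) False (?b ?M) = Pi_pmf (dom ?M) False (?b M)"
    using assms by (intro Pi_pmf_cong) (auto simp: restrict_map_def split: if_splits)
  also have "\<dots> = map_pmf (\<lambda>f x. if x \<in> dom ?M then f x else False) (Pi_pmf (dom M) False (?b M))"
    by (rule Pi_pmf_subset[OF assms sub])
  finally show ?thesis
    unfolding completions_def map_pmf_comp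
    by (auto simp: map_pmf_comp restrict_map_def intro!: map_pmf_cong split: if_splits)
qed

section \<open>The value of the clairvoyant problem on a fixed arrival path\<close>

text \<open>The data of the model, apart from the horizon and the arrivals.\<close>

locale queue =
  fixes I J :: nat
    and mu :: "nat \<Rightarrow> nat \<Rightarrow> ereal"
    and r :: "nat \<Rightarrow> nat \<Rightarrow> real"
  assumes mu_ge_1: "\<And>i j. i < I \<Longrightarrow> j < J \<Longrightarrow> 1 \<le> mu i j"
    and r_nonneg: "\<And>i d. i < I \<Longrightarrow> 0 \<le> r i d"
    and r_antimono: "\<And>i d d'. i < I \<Longrightarrow> d \<le> d' \<Longrightarrow> r i d' \<le> r i d"
begin

text \<open>
  The reward earned by completing exactly the jobs of \<open>C\<close> in slot \<open>t\<close>. A job that has not yet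
  arrived counts with delay \<open>0\<close>, the subtraction being truncated, so that every summand is
  non-increasing in \<open>t\<close>.
\<close>

definition completed_reward :: "nat \<Rightarrow> job set \<Rightarrow> real" where
  "completed_reward t C = (\<Sum>(i, s)\<in>C. r i (t - s))"

text \<open>Finite sets of jobs of existing buffers, the sets on which the assumptions on \<open>r\<close> apply.\<close>

definition job_set :: "job set \<Rightarrow> bool" where
  "job_set R \<longleftrightarrow> finite R \<and> fst ` R \<subseteq> {..<I}"

text \<open>
  The Bellman recursion: \<open>opt_value n t R\<close> is the optimal expected reward over the \<open>n\<close> slots
  \<open>t, \<dots>, t + n - 1\<close> when the jobs of \<open>R\<close> are uncompleted. The set \<open>R\<close> includes jobs that
  arrive after slot \<open>t\<close>, so that arrivals are known in advance.
\<close>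

primrec opt_value :: "nat \<Rightarrow> nat \<Rightarrow> job set \<Rightarrow> real" where
  "opt_value 0 t R = 0"
| "opt_value (Suc n) t R =
     (MAX M\<in>{M. is_matching J (arrived R t) M}.
        measure_pmf.expectation (completions mu M)
          (\<lambda>C. completed_reward t C + opt_value n (Suc t) (R - C)))"

lemma job_set_subset: "job_set R \<Longrightarrow> S \<subseteq> R \<Longrightarrow> job_set S"
  by (auto simp: job_set_def intro: finite_subset)

lemma job_set_finite: "job_set R \<Longrightarrow> finite R"
  by (simp add: job_set_def)

lemma arrived_subset: "arrived R t \<subseteq> R"
  by (auto simp: arrived_def)

lemma job_set_arrived: "job_set R \<Longrightarrow> job_set (arrived R t)"
  using job_set_subset arrived_subset by blast

lemma finite_arrived_matchings: "job_set R \<Longrightarrow> finite {M. is_matching J (arrived R t) M}"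
  by (intro finite_matchings job_set_finite job_set_arrived)

lemma completed_reward_nonneg: "job_set C \<Longrightarrow> 0 \<le> completed_reward t C"
  unfolding completed_reward_def job_set_def by (intro sum_nonneg) (auto intro!: r_nonneg)

lemma completed_reward_antimono:
  assumes "job_set C"
  shows "completed_reward (Suc t) C \<le> completed_reward t C"
  unfolding completed_reward_def
proof (rule sum_mono, clarify)
  fix i s assume "(i, s) \<in> C"
  then have "i < I" using assms by (force simp: job_set_def)
  then show "r i (Suc t - s) \<le> r i (t - s)" by (rule r_antimono) simp
qed

lemma completed_reward_Int_Diff:
  "finite B \<Longrightarrow> completed_reward t B = completed_reward t (B \<inter> D) + completed_reward t (B - D)"
  unfolding completed_reward_def by (rule sum.Int_Diff)

lemma completions_job_set:
  "job_set S \<Longrightarrow> is_matching J S M \<Longrightarrow> C \<in> set_pmf (completions mu M) \<Longrightarrow> job_set C"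
  using set_completions_subset by (meson is_matching_def job_set_subset)

text \<open>
  As distinct servers serve distinct jobs, the reward of a slot is the sum over the servers of the
  reward earned there.
\<close>

lemma expectation_completed_reward:
  assumes S: "job_set S" and M: "is_matching J S M"
  shows "measure_pmf.expectation (completions mu M) (completed_reward t) = slot_reward mu r t M"
proof -
  define w where "w = (\<lambda>k::job. case k of (i, s) \<Rightarrow> r i (t - s))"
  define b where "b = (\<lambda>j. bernoulli_pmf (completion_prob mu (fst (the (M j))) j))"
  let ?P = "Pi_pmf (dom M) False b"
  note fin = is_matching_finite_dom[OF M]
  have inj: "inj_on (\<lambda>j. the (M j)) (dom M)"
    using M by (auto simp: is_matching_def inj_on_def dom_def)
  have finP: "finite (set_pmf ?P)"
    using fin by (subst set_Pi_pmf) (auto intro!: finite_PiE_dflt intro: finite_subset[of _ UNIV])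
  have reward: "completed_reward t {k. \<exists>j. M j = Some k \<and> f j}
                  = (\<Sum>j\<in>dom M. if f j then w (the (M j)) else 0)" for f
  proof -
    have "{k. \<exists>j. M j = Some k \<and> f j} = (\<lambda>j. the (M j)) ` {j \<in> dom M. f j}"
      by (auto simp: image_iff dom_def) (metis option.sel)
    then have "completed_reward t {k. \<exists>j. M j = Some k \<and> f j}
                 = sum w ((\<lambda>j. the (M j)) ` {j \<in> dom M. f j})"
      by (simp add: completed_reward_def w_def)
    also have "\<dots> = (\<Sum>j\<in>{j \<in> dom M. f j}. w (the (M j)))"
      using inj by (subst sum.reindex) (auto intro: inj_on_subset)
    also have "\<dots> = (\<Sum>j\<in>dom M. if f j then w (the (M j)) else 0)"
      using fin by (simp add: sum.inter_filter)
    finally show ?thesis .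
  qed
  have comp: "measure_pmf.expectation ?P (\<lambda>f. if f j then w (the (M j)) else 0)
                = w (the (M j)) * completion_prob mu (fst (the (M j))) j" if j: "j \<in> dom M" for j
  proof -
    let ?p = "completion_prob mu (fst (the (M j))) j"
    have "the (M j) \<in> S" "j < J" using j M by (auto simp: is_matching_def ran_def)
    then have "1 \<le> mu (fst (the (M j))) j"
      using S by (intro mu_ge_1) (auto simp: job_set_def)
    then have p: "0 \<le> ?p \<and> ?p \<le> 1"
      unfolding completion_prob_def
      by (cases "mu (fst (the (M j))) j") (auto simp: one_ereal_def)
    have "measure_pmf.expectation ?P (\<lambda>f. if f j then w (the (M j)) else 0)
            = measure_pmf.expectation (map_pmf (\<lambda>f. f j) ?P) (\<lambda>x. if x then w (the (M j)) else 0)"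
      by simp
    also have "map_pmf (\<lambda>f. f j) ?P = bernoulli_pmf ?p"
      using fin j by (simp add: Pi_pmf_component b_def)
    finally show ?thesis using p by simp
  qed
  have "measure_pmf.expectation (completions mu M) (completed_reward t)
          = measure_pmf.expectation ?P (\<lambda>f. \<Sum>j\<in>dom M. if f j then w (the (M j)) else 0)"
    by (simp add: completions_def b_def reward)
  also have "\<dots> = (\<Sum>j\<in>dom M. measure_pmf.expectation ?P (\<lambda>f. if f j then w (the (M j)) else 0))"
    by (intro Bochner_Integration.integral_sum integrable_measure_pmf_finite finP)
  also have "\<dots> = slot_reward mu r t M"
    using comp by (auto simp: slot_reward_def w_def intro!: sum.cong split: prod.splits)
  finally show ?thesis .
qed

lemma opt_value_ge_step:
  assumes "job_set R" and "is_matching J (arrived R t) M"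
  shows "measure_pmf.expectation (completions mu M)
           (\<lambda>C. completed_reward t C + opt_value n (Suc t) (R - C)) \<le> opt_value (Suc n) t R"
  using assms by (auto intro!: Max_ge simp: finite_arrived_matchings)

lemma opt_value_attained:
  assumes "job_set R"
  obtains M where "is_matching J (arrived R t) M"
    and "opt_value (Suc n) t R = measure_pmf.expectation (completions mu M)
           (\<lambda>C. completed_reward t C + opt_value n (Suc t) (R - C))"
proof -
  let ?f = "\<lambda>M. measure_pmf.expectation (completions mu M)
           (\<lambda>C. completed_reward t C + opt_value n (Suc t) (R - C))"
  have "Max (?f ` {M. is_matching J (arrived R t) M}) \<in> ?f ` {M. is_matching J (arrived R t) M}"
    using assms is_matching_empty by (intro Max_in) (auto simp: finite_arrived_matchings)
  then show ?thesis using that by auto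
qed

text \<open>A matching of the jobs of \<open>S\<close> is also one of the jobs of \<open>R\<close>.\<close>

lemma opt_value_mono:
  assumes "job_set R" and "S \<subseteq> R"
  shows "opt_value n t S \<le> opt_value n t R"
  using assms
proof (induction n arbitrary: t R S)
  case (Suc n)
  have "job_set S" using Suc.prems job_set_subset by blast
  then obtain M where M: "is_matching J (arrived S t) M"
    and opt: "opt_value (Suc n) t S = measure_pmf.expectation (completions mu M)
                (\<lambda>C. completed_reward t C + opt_value n (Suc t) (S - C))"
    by (rule opt_value_attained)
  have "opt_value (Suc n) t S \<le> measure_pmf.expectation (completions mu M)
          (\<lambda>C. completed_reward t C + opt_value n (Suc t) (R - C))"
    unfolding opt
  proof (rule expectation_mono_finite)
    show "finite (set_pmf (completions mu M))"
      using M by (intro finite_set_completions is_matching_finite_dom)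
    show "completed_reward t C + opt_value n (Suc t) (S - C)
            \<le> completed_reward t C + opt_value n (Suc t) (R - C)" for C
      using Suc.IH[of "R - C" "S - C" "Suc t"] Suc.prems job_set_subset by auto
  qed
  also have "\<dots> \<le> opt_value (Suc n) t R"
    using Suc.prems M
    by (intro opt_value_ge_step) (auto elim!: is_matching_mono simp: arrived_def)
  finally show ?case .
qed simp

text \<open>
  With the jobs of \<open>D\<close> removed, the optimal matching for \<open>R\<close> is imitated by withdrawing its servers
  from \<open>D\<close>. The loss in slot \<open>t\<close> comes from the completed jobs of \<open>D\<close>, and by induction the later
  loss is at most what the other jobs of \<open>D\<close> would earn in slot \<open>Suc t\<close>, hence in slot \<open>t\<close>.
\<close>

lemma opt_value_le_removed:
  assumes "job_set R" and "D \<subseteq> R"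
  shows "opt_value n t R \<le> opt_value n t (R - D) + completed_reward t D"
  using assms
proof (induction n arbitrary: t R D)
  case 0
  then show ?case using completed_reward_nonneg job_set_subset by simp
next
  case (Suc n)
  obtain M where M: "is_matching J (arrived R t) M"
    and opt: "opt_value (Suc n) t R = measure_pmf.expectation (completions mu M)
                (\<lambda>C. completed_reward t C + opt_value n (Suc t) (R - C))"
    using Suc.prems(1) by (rule opt_value_attained)
  let ?M = "M |` {j. the (M j) \<notin> D}"
  have fin: "finite (set_pmf (completions mu M))"
    using M by (intro finite_set_completions is_matching_finite_dom)
  have D: "job_set D" using Suc.prems job_set_subset by blast
  have M': "is_matching J (arrived (R - D) t) ?M"
    using M by (fastforce simp: is_matching_def arrived_def ran_def restrict_map_def inj_on_def
        dom_def split: if_splits)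
  have "opt_value (Suc n) t R \<le> measure_pmf.expectation (completions mu M)
          (\<lambda>C. (completed_reward t (C - D) + opt_value n (Suc t) (R - D - (C - D)))
                  + completed_reward t D)"
    unfolding opt
  proof (rule expectation_mono_finite[OF fin])
    fix C assume "C \<in> set_pmf (completions mu M)"
    then have C: "job_set C"
      using completions_job_set[OF job_set_arrived[OF Suc.prems(1)] M] by blast
    have "opt_value n (Suc t) (R - C)
            \<le> opt_value n (Suc t) (R - C - (D - C)) + completed_reward (Suc t) (D - C)"
      using Suc.prems job_set_subset by (intro Suc.IH) auto
    moreover have "R - C - (D - C) = R - D - (C - D)" by auto
    moreover have "completed_reward (Suc t) (D - C) \<le> completed_reward t (D - C)"
      using D job_set_subset by (intro completed_reward_antimono) auto
    moreover have "completed_reward t C = completed_reward t (C \<inter> D) + completed_reward t (C - D)"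
      using C by (intro completed_reward_Int_Diff job_set_finite)
    moreover have "completed_reward t D = completed_reward t (C \<inter> D) + completed_reward t (D - C)"
      using completed_reward_Int_Diff[OF job_set_finite[OF D]] by (simp add: Int_commute)
    ultimately show "completed_reward t C + opt_value n (Suc t) (R - C)
        \<le> (completed_reward t (C - D) + opt_value n (Suc t) (R - D - (C - D)))
            + completed_reward t D"
      by simp
  qed
  also have "\<dots> = measure_pmf.expectation (completions mu ?M)
          (\<lambda>C. completed_reward t C + opt_value n (Suc t) (R - D - C)) + completed_reward t D"
    using fin M
    by (simp add: completions_restrict is_matching_finite_dom integrable_measure_pmf_finite)
  also have "\<dots> \<le> opt_value (Suc n) t (R - D) + completed_reward t D"
    using opt_value_ge_step[OF _ M'] Suc.prems job_set_subset by simp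
  finally show ?case .
qed

lemma opt_value_le_myopic_step:
  assumes R: "job_set R"
    and M: "is_matching J (arrived R t) M"
    and myopic: "\<And>M'. is_matching J (arrived R t) M' \<Longrightarrow> slot_reward mu r t M' \<le> slot_reward mu r t M"
  shows "opt_value (Suc n) t R \<le> measure_pmf.expectation (completions mu M)
           (\<lambda>C. 2 * completed_reward t C + opt_value n (Suc t) (R - C))"
proof -
  note arr = job_set_arrived[OF R, of t]
  have fin: "finite (set_pmf (completions mu N))" if "is_matching J (arrived R t) N" for N
    using that by (intro finite_set_completions is_matching_finite_dom)
  obtain N where N: "is_matching J (arrived R t) N"
    and opt: "opt_value (Suc n) t R = measure_pmf.expectation (completions mu N)
                (\<lambda>C. completed_reward t C + opt_value n (Suc t) (R - C))"
    using R by (rule opt_value_attained)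
  have "opt_value (Suc n) t R \<le> measure_pmf.expectation (completions mu N)
                (\<lambda>C. completed_reward t C + opt_value n (Suc t) R)"
    unfolding opt by (intro expectation_mono_finite fin N add_left_mono opt_value_mono R) auto
  also have "\<dots> = slot_reward mu r t N + opt_value n (Suc t) R"
    using fin[OF N]
    by (simp add: integrable_measure_pmf_finite expectation_completed_reward[OF arr N])
  also have "\<dots> \<le> slot_reward mu r t M + opt_value n (Suc t) R"
    using myopic[OF N] by simp
  also have "\<dots> = measure_pmf.expectation (completions mu M)
                (\<lambda>C. completed_reward t C + opt_value n (Suc t) R)"
    using fin[OF M]
    by (simp add: integrable_measure_pmf_finite expectation_completed_reward[OF arr M])
  also have "\<dots> \<le> measure_pmf.expectation (completions mu M)
           (\<lambda>C. 2 * completed_reward t C + opt_value n (Suc t) (R - C))"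
  proof (rule expectation_mono_finite[OF fin[OF M]])
    fix C assume C: "C \<in> set_pmf (completions mu M)"
    then have "C \<subseteq> R"
      using set_completions_subset M arrived_subset by (fastforce simp: is_matching_def)
    then have "opt_value n (Suc t) R
        \<le> opt_value n (Suc t) (R - C) + completed_reward (Suc t) C"
      by (rule opt_value_le_removed[OF R])
    then show "completed_reward t C + opt_value n (Suc t) R
        \<le> 2 * completed_reward t C + opt_value n (Suc t) (R - C)"
      using completed_reward_antimono[OF completions_job_set[OF arr M C], of t] by simp
  qed
  finally show ?thesis .
qed

section \<open>Values along trajectories\<close>

text \<open>The jobs of the path \<open>A\<close>, arrived or not, that the history \<open>h\<close> leaves uncompleted.\<close>

definition uncompleted :: "job set \<Rightarrow> history \<Rightarrow> job set" where
  "uncompleted A h = A - (\<Union>(M, C) \<in> set h. C)"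

lemma uncompleted_Nil: "uncompleted A [] = A"
  by (simp add: uncompleted_def)

lemma uncompleted_snoc: "uncompleted A (h @ [(M, C)]) = uncompleted A h - C"
  by (auto simp: uncompleted_def)

lemma available_eq_arrived: "available A h = arrived (uncompleted A h) (length h)"
  by (auto simp: available_def arrived_def uncompleted_def)

lemma total_reward_snoc:
  "total_reward r (h @ [(M, C)]) = total_reward r h + completed_reward (length h) C"
  by (simp add: total_reward_def completed_reward_def nth_append)

lemma arrival_paths_job_set: "A \<in> arrival_paths I T \<Longrightarrow> job_set A"
  by (auto simp: arrival_paths_def job_set_def intro: finite_subset)

lemma uncompleted_job_set: "A \<in> arrival_paths I T \<Longrightarrow> job_set (uncompleted A h)"
  by (rule job_set_subset[OF arrival_paths_job_set]) (auto simp: uncompleted_def)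

lemma finite_set_policy:
  assumes "\<sigma> \<in> clairvoyant_policies I J T" and "A \<in> arrival_paths I T" and "length h < T"
  shows "finite (set_pmf (\<sigma> A h))"
  using assms
  by (intro finite_subset[OF _ finite_arrived_matchings[OF uncompleted_job_set[OF assms(2), of h],
          of "length h"]])
    (auto simp: clairvoyant_policies_def available_eq_arrived)

lemma finite_set_policy_completions:
  assumes "\<sigma> \<in> clairvoyant_policies I J T" and "A \<in> arrival_paths I T" and "length h < T"
    and "M \<in> set_pmf (\<sigma> A h)"
  shows "finite (set_pmf (completions mu M))"
proof -
  have "is_matching J (available A h) M"
    using assms by (auto simp: clairvoyant_policies_def)
  then show ?thesis by (intro finite_set_completions is_matching_finite_dom)
qed

lemma length_trajectory: "h \<in> set_pmf (trajectory mu \<sigma> A t) \<Longrightarrow> length h = t"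
  by (induction t arbitrary: h) auto

lemma finite_set_trajectory:
  assumes "\<sigma> \<in> clairvoyant_policies I J T" and "A \<in> arrival_paths I T" and "t \<le> T"
  shows "finite (set_pmf (trajectory mu \<sigma> A t))"
  using assms(3)
proof (induction t)
  case (Suc t)
  have "finite (set_pmf (completions mu M))"
    if "h \<in> set_pmf (trajectory mu \<sigma> A t)" "M \<in> set_pmf (\<sigma> A h)" for h M
    using assms(1,2) _ that(2)
    by (rule finite_set_policy_completions) (use Suc.prems length_trajectory[OF that(1)] in simp)
  moreover have "finite (set_pmf (\<sigma> A h))" if "h \<in> set_pmf (trajectory mu \<sigma> A t)" for h
    using that assms Suc.prems length_trajectory by (intro finite_set_policy[of \<sigma> T]) auto
  ultimately show ?case using Suc by auto
qed simp

lemma expectation_trajectory_Suc: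
  fixes g :: "history \<Rightarrow> real"
  assumes \<sigma>: "\<sigma> \<in> clairvoyant_policies I J T" and A: "A \<in> arrival_paths I T" and t: "t < T"
  shows "measure_pmf.expectation (trajectory mu \<sigma> A (Suc t)) g =
           measure_pmf.expectation (trajectory mu \<sigma> A t) (\<lambda>h.
             measure_pmf.expectation (\<sigma> A h) (\<lambda>M.
               measure_pmf.expectation (completions mu M) (\<lambda>C. g (h @ [(M, C)]))))"
proof -
  have fc: "finite (set_pmf (completions mu M))"
    if "h \<in> set_pmf (trajectory mu \<sigma> A t)" "M \<in> set_pmf (\<sigma> A h)" for h M
    using \<sigma> A _ that(2)
    by (rule finite_set_policy_completions) (use t length_trajectory[OF that(1)] in simp)
  have fp: "finite (set_pmf (\<sigma> A h))" if "h \<in> set_pmf (trajectory mu \<sigma> A t)" for h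
    using that \<sigma> A t length_trajectory by (intro finite_set_policy[of \<sigma> T]) auto
  have ft: "finite (set_pmf (trajectory mu \<sigma> A t))"
    using \<sigma> A t by (intro finite_set_trajectory) auto
  show ?thesis
    using ft fp fc
    by (auto simp: expectation_bind_finite AE_measure_pmf_iff intro!: integral_cong_AE)
qed

text \<open>
  For any policy, the expectation of the reward so far plus the value still to come does not
  increase from one slot to the next, and it starts at \<open>opt_value T 0 A\<close>.
\<close>

lemma clairvoyant_value_bound:
  assumes \<sigma>: "\<sigma> \<in> clairvoyant_policies I J T" and A: "A \<in> arrival_paths I T" and "t \<le> T"
  shows "measure_pmf.expectation (trajectory mu \<sigma> A t)
           (\<lambda>h. total_reward r h + opt_value (T - t) t (uncompleted A h)) \<le> opt_value T 0 A"
  using \<open>t \<le> T\<close>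
proof (induction t)
  case 0
  then show ?case by (simp add: total_reward_def uncompleted_Nil)
next
  case (Suc t)
  then have t: "t < T" by simp
  define n where "n = T - Suc t"
  have n: "T - t = Suc n" "T - Suc t = n" using t by (auto simp: n_def)
  have "measure_pmf.expectation (trajectory mu \<sigma> A (Suc t))
           (\<lambda>h. total_reward r h + opt_value (T - Suc t) (Suc t) (uncompleted A h))
        \<le> measure_pmf.expectation (trajectory mu \<sigma> A t)
           (\<lambda>h. total_reward r h + opt_value (T - t) t (uncompleted A h))"
    unfolding expectation_trajectory_Suc[OF \<sigma> A t]
  proof (rule expectation_mono_finite, goal_cases)
    case 1
    show ?case using \<sigma> A t by (intro finite_set_trajectory) auto
  next
    case (2 h)
    then have len: "length h = t" by (rule length_trajectory)
    show ?case
    proof (rule expectation_le_const)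
      show "finite (set_pmf (\<sigma> A h))" using \<sigma> A t len by (intro finite_set_policy) auto
      fix M assume "M \<in> set_pmf (\<sigma> A h)"
      then have M: "is_matching J (arrived (uncompleted A h) t) M"
        using \<sigma> A t len by (auto simp: clairvoyant_policies_def available_eq_arrived)
      have "finite (set_pmf (completions mu M))"
        using M by (intro finite_set_completions is_matching_finite_dom)
      then have "measure_pmf.expectation (completions mu M) (\<lambda>C. total_reward r (h @ [(M, C)])
              + opt_value n (Suc t) (uncompleted A (h @ [(M, C)])))
          = total_reward r h + measure_pmf.expectation (completions mu M)
              (\<lambda>C. completed_reward t C + opt_value n (Suc t) (uncompleted A h - C))"
        by (simp add: total_reward_snoc uncompleted_snoc len add.assoc integrable_measure_pmf_finite)
      also have "\<dots> \<le> total_reward r h + opt_value (Suc n) t (uncompleted A h)"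
        using A M by (intro add_left_mono opt_value_ge_step uncompleted_job_set)
      finally show "measure_pmf.expectation (completions mu M) (\<lambda>C. total_reward r (h @ [(M, C)])
              + opt_value (T - Suc t) (Suc t) (uncompleted A (h @ [(M, C)])))
          \<le> total_reward r h + opt_value (T - t) t (uncompleted A h)"
        by (simp only: n)
    qed
  qed
  also have "\<dots> \<le> opt_value T 0 A" using Suc by simp
  finally show ?case .
qed

text \<open>
  For a myopic policy, the expectation of twice the reward so far plus the value still to come does
  not decrease from one slot to the next.
\<close>

lemma myopic_value_bound:
  assumes \<pi>: "\<pi> \<in> myopic_policies I J T mu r" and A: "A \<in> arrival_paths I T" and "t \<le> T"
  shows "opt_value T 0 A \<le> measure_pmf.expectation (trajectory mu \<pi> A t)
           (\<lambda>h. 2 * total_reward r h + opt_value (T - t) t (uncompleted A h))"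
  using \<open>t \<le> T\<close>
proof (induction t)
  case 0
  then show ?case by (simp add: total_reward_def uncompleted_Nil)
next
  case (Suc t)
  then have t: "t < T" by simp
  define n where "n = T - Suc t"
  have n: "T - t = Suc n" "T - Suc t = n" using t by (auto simp: n_def)
  have \<sigma>: "\<pi> \<in> clairvoyant_policies I J T"
    using \<pi> by (simp add: myopic_policies_def adaptive_policies_def)
  have "opt_value T 0 A \<le> measure_pmf.expectation (trajectory mu \<pi> A t)
           (\<lambda>h. 2 * total_reward r h + opt_value (T - t) t (uncompleted A h))"
    using Suc by simp
  also have "\<dots> \<le> measure_pmf.expectation (trajectory mu \<pi> A (Suc t))
           (\<lambda>h. 2 * total_reward r h + opt_value (T - Suc t) (Suc t) (uncompleted A h))"
    unfolding expectation_trajectory_Suc[OF \<sigma> A t]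
  proof (rule expectation_mono_finite, goal_cases)
    case 1
    show ?case using \<sigma> A t by (intro finite_set_trajectory) auto
  next
    case (2 h)
    then have len: "length h = t" by (rule length_trajectory)
    show ?case
    proof (rule expectation_ge_const)
      show "finite (set_pmf (\<pi> A h))" using \<sigma> A t len by (intro finite_set_policy) auto
      fix M assume M_in: "M \<in> set_pmf (\<pi> A h)"
      then have M: "is_matching J (arrived (uncompleted A h) t) M"
        using \<sigma> A t len by (auto simp: clairvoyant_policies_def available_eq_arrived)
      have myopic: "slot_reward mu r t M' \<le> slot_reward mu r t M"
        if "is_matching J (arrived (uncompleted A h) t) M'" for M'
        using that \<pi> A t len M_in by (auto simp: myopic_policies_def available_eq_arrived)
      have "2 * total_reward r h + opt_value (Suc n) t (uncompleted A h)
          \<le> 2 * total_reward r h + measure_pmf.expectation (completions mu M)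
              (\<lambda>C. 2 * completed_reward t C + opt_value n (Suc t) (uncompleted A h - C))"
        using A M myopic by (intro add_left_mono opt_value_le_myopic_step uncompleted_job_set)
      also have "finite (set_pmf (completions mu M))"
        using M by (intro finite_set_completions is_matching_finite_dom)
      then have "2 * total_reward r h + measure_pmf.expectation (completions mu M)
              (\<lambda>C. 2 * completed_reward t C + opt_value n (Suc t) (uncompleted A h - C))
          = measure_pmf.expectation (completions mu M) (\<lambda>C. 2 * total_reward r (h @ [(M, C)])
              + opt_value n (Suc t) (uncompleted A (h @ [(M, C)])))"
        by (simp add: total_reward_snoc uncompleted_snoc len add.assoc distrib_left
            integrable_measure_pmf_finite)
      finally show "2 * total_reward r h + opt_value (T - t) t (uncompleted A h)
          \<le> measure_pmf.expectation (completions mu M) (\<lambda>C. 2 * total_reward r (h @ [(M, C)])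
              + opt_value (T - Suc t) (Suc t) (uncompleted A (h @ [(M, C)])))"
        by (simp only: n)
    qed
  qed
  finally show ?case .
qed

lemma clairvoyant_le_twice_myopic:
  assumes arr: "set_pmf arr \<subseteq> arrival_paths I T"
    and \<pi>: "\<pi> \<in> myopic_policies I J T mu r" and \<sigma>: "\<sigma> \<in> clairvoyant_policies I J T"
  shows "expected_reward T mu r arr \<sigma> \<le> 2 * expected_reward T mu r arr \<pi>"
proof -
  have \<pi>': "\<pi> \<in> clairvoyant_policies I J T"
    using \<pi> by (simp add: myopic_policies_def adaptive_policies_def)
  have fin: "finite (set_pmf arr)"
    using arr by (rule finite_subset) (simp add: arrival_paths_def)
  have expected: "expected_reward T mu r arr \<rho>
      = measure_pmf.expectation arr
          (\<lambda>A. measure_pmf.expectation (trajectory mu \<rho> A T) (total_reward r))"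
    if "\<rho> \<in> clairvoyant_policies I J T" for \<rho>
    unfolding expected_reward_def using that arr
    by (intro expectation_bind_finite fin finite_set_trajectory) auto
  have "expected_reward T mu r arr \<sigma> \<le> measure_pmf.expectation arr
          (\<lambda>A. 2 * measure_pmf.expectation (trajectory mu \<pi> A T) (total_reward r))"
    unfolding expected[OF \<sigma>]
  proof (rule expectation_mono_finite[OF fin])
    fix A assume "A \<in> set_pmf arr"
    then have "A \<in> arrival_paths I T" using arr by blast
    then show "measure_pmf.expectation (trajectory mu \<sigma> A T) (total_reward r)
        \<le> 2 * measure_pmf.expectation (trajectory mu \<pi> A T) (total_reward r)"
      using clairvoyant_value_bound[OF \<sigma>, of A T] myopic_value_bound[OF \<pi>, of A T] by simp
  qed
  also have "\<dots> = 2 * expected_reward T mu r arr \<pi>"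
    by (simp add: expected[OF \<pi>'])
  finally show ?thesis .
qed

end

theorem mainTheorem10:
  fixes I J T :: nat
    and mu :: "nat \<Rightarrow> nat \<Rightarrow> ereal"
    and r :: "nat \<Rightarrow> nat \<Rightarrow> real"
    and arr :: "job set pmf"
    and \<pi> :: policy
  assumes "\<And>i j. i < I \<Longrightarrow> j < J \<Longrightarrow> 1 \<le> mu i j"
    and "\<And>i d. i < I \<Longrightarrow> 0 \<le> r i d"
    and "\<And>i d d'. i < I \<Longrightarrow> d \<le> d' \<Longrightarrow> r i d' \<le> r i d"
    and "set_pmf arr \<subseteq> arrival_paths I T"
    and "\<pi> \<in> myopic_policies I J T mu r"
  shows "optimal_reward (adaptive_policies I J T) T mu r arr / 2
           \<le> ereal (expected_reward T mu r arr \<pi>) \<and>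
         optimal_reward (clairvoyant_policies I J T) T mu r arr / 2
           \<le> ereal (expected_reward T mu r arr \<pi>)"
proof -
  interpret queue I J mu r
    using assms(1-3) by unfold_locales
  have half: "optimal_reward P T mu r arr / 2 \<le> ereal (expected_reward T mu r arr \<pi>)"
    if "P \<subseteq> clairvoyant_policies I J T" for P
  proof -
    have "optimal_reward P T mu r arr \<le> ereal (2 * expected_reward T mu r arr \<pi>)"
      unfolding optimal_reward_def
      using that clairvoyant_le_twice_myopic[OF assms(4,5)] by (intro SUP_least) auto
    then have "optimal_reward P T mu r arr / 2 \<le> ereal (2 * expected_reward T mu r arr \<pi>) / 2"
      by (intro ereal_divide_right_mono) auto
    then show ?thesis by simp
  qed
  moreover have "adaptive_policies I J T \<subseteq> clairvoyant_policies I J T"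
    by (auto simp: adaptive_policies_def)
  ultimately show ?thesis by blast
qed

end
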